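(* Suppose $\alpha_n$ is bounded above, but $\log \alpha_n = o (\log n)$. Then $$M_n - \log n - (\alpha_n - 1) \log \log n + \log \Gamma (\alpha_n)$$ converges in distribution to $G$ as $n\to\infty$.
   Context: Let $(\alpha_n)_{n\ge 1}$ be a sequence of positive real numbers. For each $n$, let $Y_{1n},\ldots,Y_{nn}$ be i.i.d. random variables with the Gamma$(\alpha_n,1)$ distribution, i.e. with density $u^{\alpha_n-1}e^{-u}/\Gamma(\alpha_n)$ on $(0,\infty)$, and let $M_n=\max\{Y_{1n},\ldots,Y_{nn}\}$. $G$ denotes the Gumbel distribution, with distribution function $G(x)=\exp(-e^{-x})$, $x\in\mathbb R$. *)

theory Defs
  imports "HOL-Probability.Probability"
begin

definition gamma_density :: "real \<Rightarrow> real \<Rightarrow> real" where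
  "gamma_density a u = (if 0 < u then u powr (a - 1) * exp (- u) / Gamma a else 0)"

definition gumbel_cdf :: "real \<Rightarrow> real" where
  "gumbel_cdf x = exp (- exp (- x))"

definition gumbel :: "real measure" where
  "gumbel = interval_measure gumbel_cdf"

lemma borel_measurable_gamma_density [measurable]: "gamma_density a \<in> borel_measurable borel"
  unfolding gamma_density_def [abs_def] by measurable

lemma prob_space_gamma_density:
  assumes "0 < a"
  shows "prob_space (density lborel (gamma_density a))"
proof
  have "emeasure (density lborel (gamma_density a)) UNIV = (\<integral>\<^sup>+ u. gamma_density a u \<partial>lborel)"
    by (simp add: emeasure_density)
  also have "\<dots> = (\<integral>\<^sup>+ u. ennreal (1 / Gamma a) *
      ennreal (indicator {0..} u * u powr (a - 1) / exp u) \<partial>lborel)"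
  proof (intro nn_integral_cong)
    fix u :: real
    show "ennreal (gamma_density a u) = ennreal (1 / Gamma a) *
        ennreal (indicator {0..} u * u powr (a - 1) / exp u)"
      using Gamma_real_pos [OF assms]
      by (subst ennreal_mult' [symmetric])
         (auto simp: gamma_density_def indicator_def exp_minus field_simps)
  qed
  also have "\<dots> = ennreal (1 / Gamma a) * ennreal (Gamma a)"
    by (subst nn_integral_cmult) (auto simp: Gamma_conv_nn_integral_real [OF assms])
  also have "\<dots> = 1"
    using Gamma_real_pos [OF assms] by (subst ennreal_mult' [symmetric]) auto
  finally show "emeasure (density lborel (gamma_density a))
      (space (density lborel (gamma_density a))) = 1"
    by simp
qed

lemma gumbel_cdf_facts:
  shows gumbel_cdf_mono: "x \<le> y \<Longrightarrow> gumbel_cdf x \<le> gumbel_cdf y"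
    and isCont_gumbel_cdf: "isCont gumbel_cdf x"
    and gumbel_cdf_at_bot: "(gumbel_cdf \<longlongrightarrow> 0) at_bot"
    and gumbel_cdf_at_top: "(gumbel_cdf \<longlongrightarrow> 1) at_top"
proof -
  show "x \<le> y \<Longrightarrow> gumbel_cdf x \<le> gumbel_cdf y"
    by (simp add: gumbel_cdf_def)
  show "isCont gumbel_cdf x"
    unfolding gumbel_cdf_def [abs_def] by (intro continuous_intros)
  have "LIM x at_bot. exp (- x) :> (at_top :: real filter)"
    by (intro filterlim_compose [OF exp_at_top] filterlim_uminus_at_top_at_bot)
  then show "(gumbel_cdf \<longlongrightarrow> 0) at_bot"
    unfolding gumbel_cdf_def [abs_def]
    by (intro filterlim_compose [OF exp_at_bot] filterlim_compose [OF filterlim_uminus_at_bot_at_top])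
  have "((\<lambda>x. exp (- x)) \<longlongrightarrow> (0::real)) at_top"
    by (intro filterlim_compose [OF exp_at_bot] filterlim_uminus_at_bot_at_top)
  then have "((\<lambda>x. exp (- exp (- x))) \<longlongrightarrow> exp (- (0::real))) at_top"
    by (intro tendsto_intros)
  then show "(gumbel_cdf \<longlongrightarrow> 1) at_top"
    by (simp add: gumbel_cdf_def [abs_def])
qed

lemma real_distribution_gumbel: "real_distribution gumbel"
  unfolding gumbel_def
  by (intro real_distribution_interval_measure gumbel_cdf_mono gumbel_cdf_at_bot gumbel_cdf_at_top
        continuous_at_imp_continuous_at_within [OF isCont_gumbel_cdf])

lemma cdf_gumbel: "cdf gumbel = gumbel_cdf"
  unfolding gumbel_def
  by (intro cdf_interval_measure gumbel_cdf_mono gumbel_cdf_at_bot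
        continuous_at_imp_continuous_at_within [OF isCont_gumbel_cdf])

end

theory Submission
  imports Defs "HOL-Real_Asymp.Real_Asymp"
begin

text \<open>
  On the half line above \<open>t\<close> the derivative of \<open>- gamma_density a\<close> is
  \<open>gamma_density a u * (1 - (a - 1) / u)\<close>, hence the tail probability at \<open>t\<close> equals the
  density at \<open>t\<close> up to a factor \<open>1 + O(1/t)\<close>, uniformly for bounded \<open>a\<close>.
  At \<open>t = ln n + (a - 1) ln (ln n) - ln (Gamma a) + x\<close> the density is exactly
  \<open>exp (- x) / n * (t / ln n) powr (a - 1)\<close>. Since \<open>ln (Gamma a) + ln a\<close> is bounded for
  bounded \<open>a\<close>, the hypothesis on \<open>ln a\<close> gives \<open>t / ln n \<longrightarrow> 1\<close>, so that \<open>n\<close> times the tail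
  converges to \<open>exp (- x)\<close>.
\<close>

section \<open>Gamma tails compared with the density\<close>

lemma gamma_density_tendsto_0: "(gamma_density a \<longlongrightarrow> 0) at_top"
proof -
  have "((\<lambda>u. u powr (a - 1) * exp (- u)) \<longlongrightarrow> 0) at_top"
    by real_asymp
  from tendsto_mult_left_zero[OF this, of "inverse (Gamma a)"]
  have "((\<lambda>u. u powr (a - 1) * exp (- u) / Gamma a) \<longlongrightarrow> 0) at_top"
    by (simp add: divide_inverse)
  moreover have "eventually (\<lambda>u. u powr (a - 1) * exp (- u) / Gamma a = gamma_density a u) at_top"
    using eventually_gt_at_top[of 0] by eventually_elim (simp add: gamma_density_def)
  ultimately show ?thesis
    by (rule Lim_transform_eventually)
qed

text \<open>The sign makes the derivative nonnegative for \<open>u\<close> beyond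
  \<open>a - 1\<close> (when \<open>0 < a\<close>), as integration by \<open>nn_integral\<close>
  requires. The factored form allows comparison with the density itself.\<close>

lemma gamma_density_has_derivative:
  assumes "0 < u"
  shows "((\<lambda>u. - gamma_density a u) has_real_derivative gamma_density a u * (1 - (a - 1) / u)) (at u)"
proof -
  let ?c = "inverse (Gamma a)"
  have "((\<lambda>u. - (u powr (a - 1) * exp (- u) * ?c)) has_real_derivative
      - ((((a - 1) * u powr (a - 1 - 1)) * exp (- u) + (exp (- u) * - 1) * u powr (a - 1)) * ?c)) (at u)"
    by (rule derivative_eq_intros has_real_derivative_powr refl assms | simp)+
  also have "- ((((a - 1) * u powr (a - 1 - 1)) * exp (- u) + (exp (- u) * - 1) * u powr (a - 1)) * ?c)
      = gamma_density a u * (1 - (a - 1) / u)"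
    using assms powr_diff[of u "a - 1" 1]
    by (simp add: gamma_density_def divide_inverse ring_distribs mult_ac)
  finally have "((\<lambda>u. - (u powr (a - 1) * exp (- u) / Gamma a)) has_real_derivative
      gamma_density a u * (1 - (a - 1) / u)) (at u)"
    by (simp add: divide_inverse)
  moreover have "eventually (\<lambda>v. gamma_density a v = v powr (a - 1) * exp (- v) / Gamma a) (nhds u)"
    using eventually_nhds_in_open[of "{0<..}" u] assms
    by (auto elim!: eventually_mono simp: gamma_density_def)
  ultimately show ?thesis
    by (subst DERIV_cong_ev[OF refl _ refl])
       (auto elim: eventually_mono)
qed

lemma gamma_density_nonneg: "0 < a \<Longrightarrow> 0 \<le> gamma_density a u"
  by (simp add: gamma_density_def Gamma_real_pos less_imp_le)

text \<open>Integrating the derivative of minus the density over the half line from \<open>t\<close>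
  gives exactly the density at \<open>t\<close>. There \<open>1 - (a - 1) / u\<close> stays between
  \<open>1 - C / t\<close> and \<open>1 + C / t\<close>, so the integral lies between these
  multiples of \<open>T\<close>. Only \<open>C\<close> enters the error, which makes the bounds
  uniform in \<open>a\<close>.\<close>

lemma gamma_tail_bounds:
  assumes a: "0 < a" and C: "\<bar>a - 1\<bar> \<le> C" and t: "C < t"
  defines "T \<equiv> measure (density lborel (gamma_density a)) {t<..}"
  shows "(1 - C / t) * T \<le> gamma_density a t"
    and "gamma_density a t \<le> (1 + C / t) * T"
proof -
  let ?D = "density lborel (gamma_density a)"
  let ?g = "gamma_density a"
  interpret D: prob_space ?D
    by (rule prob_space_gamma_density[OF a])
  have t0: "0 < t" and C0: "0 \<le> C" using C t by auto
  have Ct: "C / t < 1" "0 \<le> C / t" using t t0 C0 by auto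
  have frac: "\<bar>(a - 1) / u\<bar> \<le> C / t" if "t \<le> u" for u
    using that t0 C C0 by (auto simp: abs_divide intro!: frac_le)
  \<comment> \<open>The fundamental theorem used below works on the closed half line,
    \<open>T\<close> on the open one; the single point \<open>t\<close> is a null set.\<close>
  have T: "(\<integral>\<^sup>+u. ennreal (?g u) * indicator {t..} u \<partial>lborel) = ennreal T"
  proof -
    have "(\<integral>\<^sup>+u. ennreal (?g u) * indicator {t..} u \<partial>lborel)
        = (\<integral>\<^sup>+u. ennreal (?g u) * indicator {t<..} u \<partial>lborel)"
      by (intro nn_integral_cong_AE, rule AE_mp[OF AE_lborel_singleton[of t]])
         (auto simp: indicator_def)
    also have "\<dots> = emeasure ?D {t<..}"
      by (simp add: emeasure_density)
    finally show ?thesis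
      by (simp add: T_def D.emeasure_eq_measure)
  qed
  have scaled: "(\<integral>\<^sup>+u. ennreal (c * ?g u) * indicator {t..} u \<partial>lborel) = ennreal (c * T)"
    if "0 \<le> c" for c
    using that by (simp add: ennreal_mult' nn_integral_cmult T mult.assoc)
  \<comment> \<open>This is where \<open>C < t\<close> enters: it keeps the factor
    nonnegative.\<close>
  have nonneg: "0 \<le> ?g u * (1 - (a - 1) / u)" if "t \<le> u" for u
    using frac[OF that] Ct gamma_density_nonneg[OF a, of u]
    by (intro mult_nonneg_nonneg) linarith+
  have sandwich: "(1 - C / t) * ?g u \<le> ?g u * (1 - (a - 1) / u)"
    "?g u * (1 - (a - 1) / u) \<le> (1 + C / t) * ?g u" if "t \<le> u" for u
    unfolding mult.commute[of "?g u"] using frac[OF that]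
    by (intro mult_right_mono gamma_density_nonneg a; linarith)+
  have "(\<integral>\<^sup>+u. ennreal (?g u * (1 - (a - 1) / u)) * indicator {t..} u \<partial>lborel)
      = ennreal (0 - (- ?g t))"
    using t0 nonneg tendsto_minus[OF gamma_density_tendsto_0[of a]]
    by (intro nn_integral_FTC_atLeast gamma_density_has_derivative) auto
  then have I: "(\<integral>\<^sup>+u. ennreal (?g u * (1 - (a - 1) / u)) * indicator {t..} u \<partial>lborel) = ennreal (?g t)"
    by simp
  have "ennreal ((1 - C / t) * T) \<le> ennreal (?g t)"
    unfolding I[symmetric] using Ct
    by (subst scaled[symmetric])
       (auto intro!: nn_integral_mono ennreal_leI sandwich split: split_indicator)
  then show "(1 - C / t) * T \<le> ?g t"
    by (simp add: ennreal_le_iff gamma_density_nonneg a)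
  have "ennreal (?g t) \<le> ennreal ((1 + C / t) * T)"
    unfolding I[symmetric] using Ct
    by (subst scaled[symmetric])
       (auto intro!: nn_integral_mono ennreal_leI sandwich split: split_indicator)
  moreover have "0 \<le> (1 + C / t) * T"
    using Ct by (simp add: T_def)
  ultimately show "?g t \<le> (1 + C / t) * T"
    by (simp add: ennreal_le_iff)
qed

section \<open>Limits of real sequences for the centring and for powers\<close>

text \<open>\<open>Gamma\<close> has a pole at 0, but \<open>Gamma (a + 1) = a * Gamma a\<close>
  splits it off as the term \<open>ln a\<close>; what remains is continuous on the compact interval
  from 0 to \<open>B\<close>, hence bounded.\<close>

lemma ln_Gamma_real_bound:
  fixes B :: real
  obtains K where "\<And>a. 0 < a \<Longrightarrow> a \<le> B \<Longrightarrow> \<bar>ln (Gamma a)\<bar> \<le> \<bar>ln a\<bar> + K"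
proof -
  have "continuous_on {0..B} (\<lambda>a. ln (Gamma (a + 1)))"
    by (intro continuous_intros continuous_on_compose2[OF continuous_on_Gamma[of "{1..B+1}"]])
       (auto elim!: nonpos_Ints_cases dest: Gamma_real_pos simp: Gamma_eq_zero_iff)
  then have "bounded ((\<lambda>a. ln (Gamma (a + 1))) ` {0..B})"
    by (intro compact_imp_bounded compact_continuous_image) auto
  then obtain K where K: "\<bar>ln (Gamma (a + 1))\<bar> \<le> K" if "a \<in> {0..B}" for a
    by (fastforce simp: bounded_iff simp del: atLeastAtMost_iff)
  show ?thesis
  proof (rule that)
    fix a :: real
    assume a: "0 < a" "a \<le> B"
    have "Gamma (a + 1) = a * Gamma a"
      using a by (intro Gamma_plus1) (auto elim!: nonpos_Ints_cases)
    then have "ln (Gamma (a + 1)) = ln a + ln (Gamma a)"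
      using a Gamma_real_pos[of a] by (simp add: ln_mult_pos)
    then show "\<bar>ln (Gamma a)\<bar> \<le> \<bar>ln a\<bar> + K"
      using K[of a] a by auto
  qed
qed

text \<open>Two uses of \<open>1 + y <= exp y\<close> give
  \<open>exp (- p / (1 - p)) <= 1 - p <= exp (- p)\<close> for \<open>p < 1\<close>. After taking
  \<open>n\<close>-th powers both sides have the same limit, since \<open>p n\<close> tends to
  0.\<close>

lemma power_one_minus_tendsto_exp:
  fixes p :: "nat \<Rightarrow> real"
  assumes p: "\<And>n. 0 \<le> p n" and lim: "(\<lambda>n. real n * p n) \<longlonglongrightarrow> c"
  shows "(\<lambda>n. (1 - p n) ^ n) \<longlonglongrightarrow> exp (- c)"
proof -
  have "(\<lambda>n. real n * p n * inverse (real n)) \<longlonglongrightarrow> 0"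
    using tendsto_mult[OF lim lim_inverse_n] by simp
  then have p0: "p \<longlonglongrightarrow> 0"
    by (rule Lim_transform_eventually)
       (auto intro!: eventually_mono[OF eventually_gt_at_top[of 0]])
  have p1: "eventually (\<lambda>n. p n < 1) sequentially"
    using order_tendstoD(2)[OF p0, of 1] by simp
  show ?thesis
  proof (rule tendsto_sandwich)
    show "eventually (\<lambda>n. exp (- (real n * p n / (1 - p n))) \<le> (1 - p n) ^ n) sequentially"
      using p1
    proof eventually_elim
      fix n assume n: "p n < 1"
      \<comment> \<open>The lower bound is the exponential inequality at
        \<open>y = p n / (1 - p n)\<close>, inverted.\<close>
      have "1 / (1 - p n) = 1 + p n / (1 - p n)"
        using n by (simp add: field_simps)
      also have "\<dots> \<le> exp (p n / (1 - p n))"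
        by (rule exp_ge_add_one_self)
      finally have "exp (- (p n / (1 - p n))) \<le> 1 - p n"
        using n by (simp add: exp_minus field_simps)
      then have "exp (- (p n / (1 - p n))) ^ n \<le> (1 - p n) ^ n"
        by (intro power_mono) auto
      then show "exp (- (real n * p n / (1 - p n))) \<le> (1 - p n) ^ n"
        by (simp add: exp_of_nat_mult[symmetric])
    qed
    show "eventually (\<lambda>n. (1 - p n) ^ n \<le> exp (- (real n * p n))) sequentially"
      using p1
    proof eventually_elim
      fix n assume n: "p n < 1"
      have "(1 - p n) ^ n \<le> exp (- p n) ^ n"
        using n exp_ge_add_one_self[of "- p n"] by (intro power_mono) auto
      then show "(1 - p n) ^ n \<le> exp (- (real n * p n))"
        by (simp add: exp_of_nat_mult[symmetric])
    qed
    have "(\<lambda>n. exp (- (real n * p n / (1 - p n)))) \<longlonglongrightarrow> exp (- (c / (1 - 0)))"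
      by (intro tendsto_intros lim p0) auto
    then show "(\<lambda>n. exp (- (real n * p n / (1 - p n)))) \<longlonglongrightarrow> exp (- c)"
      by simp
    show "(\<lambda>n. exp (- (real n * p n))) \<longlonglongrightarrow> exp (- c)"
      by (intro tendsto_intros lim)
  qed
qed

text \<open>After division by \<open>ln n\<close> only the term \<open>ln n\<close> survives:
  boundedness of \<open>\<alpha>\<close> handles the iterated logarithm, while
  \<open>ln (Gamma (\<alpha> n))\<close>, which may be unbounded if \<open>\<alpha> n\<close>
  approaches 0, is controlled by \<open>\<bar>ln (\<alpha> n)\<bar> + K\<close>.\<close>

lemma gamma_quantile_asymp:
  fixes \<alpha> :: "nat \<Rightarrow> real"
  assumes pos: "\<And>n. n \<ge> 1 \<Longrightarrow> 0 < \<alpha> n" and B: "\<And>n. n \<ge> 1 \<Longrightarrow> \<alpha> n \<le> B"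
    and small: "(\<lambda>n. ln (\<alpha> n)) \<in> o(\<lambda>n. ln (real n))"
  shows "(\<lambda>n. (x + ln (real n) + (\<alpha> n - 1) * ln (ln (real n)) - ln (Gamma (\<alpha> n))) / ln (real n))
    \<longlonglongrightarrow> 1"
proof -
  let ?l = "\<lambda>n. ln (real n)"
  \<comment> \<open>From 2 on \<open>ln n\<close> is positive, so it can be divided by and
    cancelled.\<close>
  have ev: "eventually (\<lambda>n. n \<ge> 2) sequentially"
    by (rule eventually_ge_at_top)
  have a0: "(\<lambda>n. ln (\<alpha> n) / ?l n) \<longlonglongrightarrow> 0"
    using small by (rule smalloD_tendsto)
  have "(\<lambda>n. ln (?l n) / ?l n) \<longlonglongrightarrow> 0"
    by real_asymp
  moreover have "eventually (\<lambda>n. norm ((\<alpha> n - 1) * (ln (?l n) / ?l n))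
      \<le> norm (ln (?l n) / ?l n) * (\<bar>B\<bar> + 1)) sequentially"
    using ev
  proof eventually_elim
    fix n :: nat assume "n \<ge> 2"
    then have "\<bar>\<alpha> n - 1\<bar> \<le> \<bar>B\<bar> + 1"
      using pos[of n] B[of n] by auto
    then show "norm ((\<alpha> n - 1) * (ln (?l n) / ?l n)) \<le> norm (ln (?l n) / ?l n) * (\<bar>B\<bar> + 1)"
      unfolding norm_mult mult.commute[of "norm (\<alpha> n - 1)"] by (intro mult_left_mono) auto
  qed
  ultimately have 1: "(\<lambda>n. (\<alpha> n - 1) * (ln (?l n) / ?l n)) \<longlonglongrightarrow> 0"
    by (rule tendsto_0_le)
  obtain K where K: "\<And>a. 0 < a \<Longrightarrow> a \<le> B \<Longrightarrow> \<bar>ln (Gamma a)\<bar> \<le> \<bar>ln a\<bar> + K"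
    using ln_Gamma_real_bound[of B] by metis
  have "(\<lambda>n. K / ?l n) \<longlonglongrightarrow> 0"
    by real_asymp
  from tendsto_add[OF tendsto_rabs[OF a0] this]
  have "(\<lambda>n. \<bar>ln (\<alpha> n) / ?l n\<bar> + K / ?l n) \<longlonglongrightarrow> 0"
    by simp
  moreover have "eventually (\<lambda>n. norm (ln (Gamma (\<alpha> n)) / ?l n)
      \<le> \<bar>ln (\<alpha> n) / ?l n\<bar> + K / ?l n) sequentially"
    using ev
  proof eventually_elim
    fix n :: nat assume n: "n \<ge> 2"
    then have "\<bar>ln (Gamma (\<alpha> n))\<bar> / ?l n \<le> (\<bar>ln (\<alpha> n)\<bar> + K) / ?l n"
      using pos[of n] B[of n] by (intro divide_right_mono K) auto
    then show "norm (ln (Gamma (\<alpha> n)) / ?l n) \<le> \<bar>ln (\<alpha> n) / ?l n\<bar> + K / ?l n"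
      using n by (simp add: add_divide_distrib abs_divide)
  qed
  ultimately have 2: "(\<lambda>n. ln (Gamma (\<alpha> n)) / ?l n) \<longlonglongrightarrow> 0"
    by (rule Lim_null_comparison[rotated])
  have 3: "(\<lambda>n. x / ?l n) \<longlonglongrightarrow> 0"
    by real_asymp
  have "(\<lambda>n. x / ?l n + 1 + (\<alpha> n - 1) * (ln (?l n) / ?l n) - ln (Gamma (\<alpha> n)) / ?l n)
      \<longlonglongrightarrow> 0 + 1 + 0 - 0"
    by (intro tendsto_intros 1 2 3)
  then have "(\<lambda>n. x / ?l n + 1 + (\<alpha> n - 1) * (ln (?l n) / ?l n) - ln (Gamma (\<alpha> n)) / ?l n)
      \<longlonglongrightarrow> 1"
    by simp
  then show ?thesis
  proof (rule Lim_transform_eventually)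
    show "eventually (\<lambda>n. x / ?l n + 1 + (\<alpha> n - 1) * (ln (?l n) / ?l n) - ln (Gamma (\<alpha> n)) / ?l n
      = (x + ?l n + (\<alpha> n - 1) * ln (?l n) - ln (Gamma (\<alpha> n))) / ?l n) sequentially"
      using ev by eventually_elim (simp add: add_divide_distrib diff_divide_distrib)
  qed
qed

lemma powr_tendsto_1:
  fixes r e :: "nat \<Rightarrow> real"
  assumes r: "r \<longlonglongrightarrow> 1" and e: "eventually (\<lambda>n. \<bar>e n\<bar> \<le> C) sequentially"
  shows "(\<lambda>n. r n powr e n) \<longlonglongrightarrow> 1"
proof -
  have "(\<lambda>n. ln (r n)) \<longlonglongrightarrow> 0"
    using tendsto_ln[OF r] by simp
  moreover have "eventually (\<lambda>n. norm (e n * ln (r n)) \<le> norm (ln (r n)) * C) sequentially"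
    using e by eventually_elim (metis abs_ge_zero abs_mult mult.commute mult_left_mono real_norm_def)
  ultimately have "(\<lambda>n. e n * ln (r n)) \<longlonglongrightarrow> 0"
    by (rule tendsto_0_le)
  then have "(\<lambda>n. exp (e n * ln (r n))) \<longlonglongrightarrow> 1"
    using tendsto_exp by fastforce
  \<comment> \<open>Positivity of \<open>r n\<close> excludes base 0, where \<open>powr\<close> is 0
    by convention.\<close>
  moreover have "eventually (\<lambda>n. exp (e n * ln (r n)) = r n powr e n) sequentially"
    using order_tendstoD(1)[OF r zero_less_one] by eventually_elim (simp add: powr_def)
  ultimately show ?thesis
    by (rule Lim_transform_eventually)
qed

section \<open>Density and tail at the centred level\<close>

text \<open>In \<open>exp (- t)\<close> the term \<open>ln (Gamma a)\<close> cancels the normalising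
  constant, \<open>ln n\<close> cancels the factor \<open>n\<close>, and the iterated logarithm
  supplies the power of \<open>ln n\<close> that turns \<open>t powr (a - 1)\<close> into a power of
  the ratio.\<close>

lemma gamma_density_at_quantile:
  assumes a: "0 < a" and n: "n \<ge> 3"
    and t: "t = x + ln (real n) + (a - 1) * ln (ln (real n)) - ln (Gamma a)" "0 < t"
  shows "real n * gamma_density a t = (t / ln (real n)) powr (a - 1) * exp (- x)"
proof -
  have l: "0 < ln (real n)" using n by simp
  have "exp (- t) = exp (- x) * Gamma a / (real n * ln (real n) powr (a - 1))"
    using n l Gamma_real_pos[OF a]
    by (simp add: t(1) exp_add exp_diff exp_minus powr_def field_simps)
  then show ?thesis
    using n l t(2) Gamma_real_pos[OF a]
    by (simp add: gamma_density_def powr_divide field_simps)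
qed

lemma gamma_tail_at_quantile:
  fixes \<alpha> :: "nat \<Rightarrow> real" and x :: real
  assumes pos: "\<And>n. n \<ge> 1 \<Longrightarrow> 0 < \<alpha> n" and B: "\<And>n. n \<ge> 1 \<Longrightarrow> \<alpha> n \<le> B"
    and small: "(\<lambda>n. ln (\<alpha> n)) \<in> o(\<lambda>n. ln (real n))"
  defines "t \<equiv> \<lambda>n. x + ln (real n) + (\<alpha> n - 1) * ln (ln (real n)) - ln (Gamma (\<alpha> n))"
  shows "(\<lambda>n. real n * measure (density lborel (gamma_density (\<alpha> n))) {t n<..}) \<longlonglongrightarrow> exp (- x)"
proof -
  \<comment> \<open>Since \<open>0 < \<alpha> n \<le> B\<close>, this dominates
    \<open>\<bar>\<alpha> n - 1\<bar>\<close>; it is also positive, so \<open>C < t n\<close> forces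
    \<open>t n\<close> to be positive.\<close>
  define C where "C = \<bar>B\<bar> + 1"
  have C: "\<bar>\<alpha> n - 1\<bar> \<le> C" if "n \<ge> 1" for n
    using pos[OF that] B[OF that] by (auto simp: C_def)
  define T where "T n = measure (density lborel (gamma_density (\<alpha> n))) {t n<..}" for n
  define g where "g n = real n * gamma_density (\<alpha> n) (t n)" for n
  have r: "(\<lambda>n. t n / ln (real n)) \<longlonglongrightarrow> 1"
    unfolding t_def by (rule gamma_quantile_asymp[OF pos B small])
  have "filterlim (\<lambda>n. ln (real n)) at_top sequentially"
    by real_asymp
  then have "filterlim (\<lambda>n. t n / ln (real n) * ln (real n)) at_top sequentially"
    by (rule filterlim_tendsto_pos_mult_at_top[OF r zero_less_one])
  then have t_top: "filterlim t at_top sequentially"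
    by (rule filterlim_mono_eventually[OF _ order_refl order_refl])
       (auto intro!: eventually_mono[OF eventually_ge_at_top[of 2]])
  have Ct: "(\<lambda>n. C / t n) \<longlonglongrightarrow> 0"
    by (intro tendsto_divide_0[OF tendsto_const] filterlim_at_top_imp_at_infinity t_top)
  have ev: "eventually (\<lambda>n. n \<ge> 3 \<and> C < t n) sequentially"
    using eventually_ge_at_top[of 3] filterlim_at_top_dense[THEN iffD1, OF t_top, rule_format, of C]
    by eventually_elim simp
  have C0: "0 < C" by (simp add: C_def add_nonneg_pos)
  have "(\<lambda>n. (t n / ln (real n)) powr (\<alpha> n - 1) * exp (- x)) \<longlonglongrightarrow> 1 * exp (- x)"
    by (intro tendsto_mult powr_tendsto_1[OF r, where C = C] tendsto_const
          eventually_mono[OF eventually_ge_at_top[of 1]] C)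
  moreover have "eventually (\<lambda>n. (t n / ln (real n)) powr (\<alpha> n - 1) * exp (- x) = g n) sequentially"
    using ev
  proof eventually_elim
    case (elim n)
    then show ?case
      unfolding g_def using C0 pos[of n]
      by (intro gamma_density_at_quantile[symmetric]) (auto simp: t_def)
  qed
  ultimately have g: "g \<longlonglongrightarrow> exp (- x)"
    using Lim_transform_eventually by fastforce
  \<comment> \<open>The two tail bounds squeeze \<open>n\<close> times the tail between multiples of
    \<open>g n\<close> whose factors tend to 1, because \<open>t n\<close> tends to
    infinity.\<close>
  have "(\<lambda>n. real n * T n) \<longlonglongrightarrow> exp (- x)"
  proof (rule tendsto_sandwich)
    show "eventually (\<lambda>n. g n / (1 + C / t n) \<le> real n * T n) sequentially"
      using ev
    proof eventually_elim
      case (elim n)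
      then have "real n * gamma_density (\<alpha> n) (t n) \<le> real n * ((1 + C / t n) * T n)"
        unfolding T_def using pos[of n] C[of n]
        by (intro mult_left_mono gamma_tail_bounds(2)) auto
      moreover have "0 < 1 + C / t n"
        using elim C0 by (auto intro!: add_pos_pos divide_pos_pos)
      ultimately show ?case
        by (simp add: g_def pos_divide_le_eq mult_ac)
    qed
    show "eventually (\<lambda>n. real n * T n \<le> g n / (1 - C / t n)) sequentially"
      using ev
    proof eventually_elim
      case (elim n)
      then have "real n * ((1 - C / t n) * T n) \<le> real n * gamma_density (\<alpha> n) (t n)"
        unfolding T_def using pos[of n] C[of n]
        by (intro mult_left_mono gamma_tail_bounds(1)) auto
      moreover have "0 < 1 - C / t n"
        using elim C0 by auto
      ultimately show ?case
        by (simp add: g_def pos_le_divide_eq mult_ac)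
    qed
    have "(\<lambda>n. g n / (1 + C / t n)) \<longlonglongrightarrow> exp (- x) / (1 + 0)"
      by (intro tendsto_intros g Ct) auto
    then show "(\<lambda>n. g n / (1 + C / t n)) \<longlonglongrightarrow> exp (- x)"
      by simp
    have "(\<lambda>n. g n / (1 - C / t n)) \<longlonglongrightarrow> exp (- x) / (1 - 0)"
      by (intro tendsto_intros g Ct) auto
    then show "(\<lambda>n. g n / (1 - C / t n)) \<longlonglongrightarrow> exp (- x)"
      by simp
  qed
  then show ?thesis
    by (simp add: T_def)
qed

section \<open>Maxima and convergence in law\<close>

text \<open>A maximum over a nonempty finite set is at most \<open>t\<close> exactly when all its
  members are, so independence turns the probability into a product of equal factors.\<close>

lemma (in prob_space) prob_Max_le:
  fixes Y :: "'i \<Rightarrow> 'a \<Rightarrow> real"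
  assumes I: "finite I" "I \<noteq> {}" and indep: "indep_vars (\<lambda>_. borel) Y I"
    and distr: "\<And>i. i \<in> I \<Longrightarrow> distr M borel (Y i) = D"
  shows "prob {\<omega> \<in> space M. Max ((\<lambda>i. Y i \<omega>) ` I) \<le> t} = measure D {..t} ^ card I"
proof -
  have Y: "Y i \<in> borel_measurable M" if "i \<in> I" for i
    using indep that by (auto simp: indep_vars_def)
  have "{\<omega> \<in> space M. Max ((\<lambda>i. Y i \<omega>) ` I) \<le> t} = (\<Inter>i\<in>I. Y i -` {..t} \<inter> space M)"
    using I by auto
  also have "prob \<dots> = (\<Prod>i\<in>I. prob (Y i -` {..t} \<inter> space M))"
    using I by (intro indep_varsD[OF indep]) auto
  also have "\<dots> = (\<Prod>i\<in>I. measure D {..t})"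
    using Y by (intro prod.cong refl) (simp add: distr[symmetric] measure_distr)
  finally show ?thesis
    by simp
qed

text \<open>Each row has its own probability space \<open>P n\<close>: convergence in distribution
  involves only the law of each normalised maximum.\<close>

theorem theorem2p4:
  fixes \<alpha> :: "nat \<Rightarrow> real"
    and P :: "nat \<Rightarrow> 'a measure"
    and Y :: "nat \<Rightarrow> nat \<Rightarrow> 'a \<Rightarrow> real"
    and M :: "nat \<Rightarrow> 'a \<Rightarrow> real"
  assumes "\<And>n. n \<ge> 1 \<Longrightarrow> \<alpha> n > 0"
    and "\<And>n. n \<ge> 1 \<Longrightarrow> prob_space (P n)"
    and "\<And>n. n \<ge> 1 \<Longrightarrow> prob_space.indep_vars (P n) (\<lambda>_. borel) (\<lambda>i. Y i n) {1..n}"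
    and "\<And>n i. n \<ge> 1 \<Longrightarrow> i \<in> {1..n} \<Longrightarrow> distributed (P n) lborel (Y i n) (gamma_density (\<alpha> n))"
    and "\<And>n \<omega>. n \<ge> 1 \<Longrightarrow> \<omega> \<in> space (P n) \<Longrightarrow> M n \<omega> = Max ((\<lambda>i. Y i n \<omega>) ` {1..n})"
    and "bdd_above (\<alpha> ` {1..})"
    and "(\<lambda>n. ln (\<alpha> n)) \<in> o(\<lambda>n. ln (real n))"
  shows "weak_conv_m
    (\<lambda>n. distr (P n) borel
      (\<lambda>\<omega>. M n \<omega> - ln (real n) - (\<alpha> n - 1) * ln (ln (real n)) + ln (Gamma (\<alpha> n))))
    gumbel"
proof -
  note pos = assms(1) and prob = assms(2) and indep = assms(3) and dens = assms(4) and Max = assms(5)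
  obtain B where B: "\<And>n. n \<ge> 1 \<Longrightarrow> \<alpha> n \<le> B"
    using assms(6) by (meson atLeast_iff bdd_above.E imageI)
  let ?D = "\<lambda>n. density lborel (gamma_density (\<alpha> n))"
  let ?Z = "\<lambda>n \<omega>. M n \<omega> - ln (real n) - (\<alpha> n - 1) * ln (ln (real n)) + ln (Gamma (\<alpha> n))"
  \<comment> \<open>The normalised maximum is at most \<open>x\<close> exactly when
    \<open>M n\<close> is at most \<open>t x n\<close>.\<close>
  define t where
    "t x n = x + ln (real n) + (\<alpha> n - 1) * ln (ln (real n)) - ln (Gamma (\<alpha> n))" for x and n :: nat
  have cdf: "cdf (distr (P n) borel (?Z n)) x = (1 - measure (?D n) {t x n<..}) ^ n"
    if n: "n \<ge> 1" for n x
  proof -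
    interpret P: prob_space "P n"
      using prob[OF n] .
    interpret D: prob_space "?D n"
      using prob_space_gamma_density[OF pos[OF n]] .
    have Y: "Y i n \<in> borel_measurable (P n)" "distr (P n) borel (Y i n) = ?D n"
      if "i \<in> {1..n}" for i
      \<comment> \<open>The density is given relative to \<open>lborel\<close>, the law is wanted on
        \<open>borel\<close>; both carry the same sigma-algebra.\<close>
      using dens[OF n that] by (auto simp: distributed_def cong: distr_cong)
    have "(\<lambda>\<omega>. Max ((\<lambda>i. Y i n \<omega>) ` {1..n})) \<in> borel_measurable (P n)"
      using Y by (intro borel_measurable_Max) auto
    then have M: "M n \<in> borel_measurable (P n)"
      using Max[OF n] by (simp cong: measurable_cong)
    have "cdf (distr (P n) borel (?Z n)) x = P.prob {\<omega> \<in> space (P n). M n \<omega> \<le> t x n}"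
      unfolding cdf_def
      by (subst measure_distr) (use M in \<open>auto simp: t_def intro!: arg_cong[where f = P.prob]\<close>)
    also have "\<dots> = P.prob {\<omega> \<in> space (P n). Max ((\<lambda>i. Y i n \<omega>) ` {1..n}) \<le> t x n}"
      using Max[OF n] by (intro arg_cong[where f = P.prob]) auto
    also have "\<dots> = measure (?D n) {..t x n} ^ n"
      using n Y by (subst P.prob_Max_le[OF _ _ indep[OF n]]) auto
    also have "measure (?D n) {..t x n} = 1 - measure (?D n) {t x n<..}"
      using D.prob_compl[of "{t x n<..}"] by (simp add: Compl_eq_Diff_UNIV[symmetric])
    finally show ?thesis .
  qed
  show ?thesis
    unfolding weak_conv_m_def weak_conv_def cdf_gumbel
  proof (intro allI impI)
    fix x
    \<comment> \<open>Here \<open>p n\<close> is the tail beyond \<open>t x n\<close> and the limit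
      \<open>c\<close> of \<open>n * p n\<close> is \<open>exp (- x)\<close>.\<close>
    have "(\<lambda>n. (1 - measure (?D n) {t x n<..}) ^ n) \<longlonglongrightarrow> exp (- exp (- x))"
      unfolding t_def
      by (intro power_one_minus_tendsto_exp gamma_tail_at_quantile[where B = B] pos B assms(7)) auto
    then show "(\<lambda>n. cdf (distr (P n) borel (?Z n)) x) \<longlonglongrightarrow> gumbel_cdf x"
      unfolding gumbel_cdf_def
      by (rule Lim_transform_eventually) (auto intro!: eventually_mono[OF eventually_ge_at_top[of 1]] simp: cdf)
  qed
qed

end
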